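(* For every integer $g\ge 0$ and every integer $r\ge 1$: there exists a totally real hyperelliptic curve $C_D$ of genus $g$ such that the Pell–Abel equation on $C_D$ has a primitive solution of degree $r$ if and only if $r>g$ (that is, such a curve exists if and only if $r>g$).
   Context: Let $D\in\mathbb{C}[x]$ be a polynomial of even degree $2g+2$ with simple zeros. The associated hyperelliptic curve $C_D$ of genus $g$ is the complex curve with affine equation $y^2=D(x)$, completed by two points at infinity (for $g=0,1$ the word "hyperelliptic" is used in this extended sense). The curve $C_D$ is called totally real if all roots of $D$ lie in $\mathbb{R}$; one then takes $D(x)=\prod_{i=0}^{g}(x-a_i)(x-b_i)$ with real numbers $a_0<b_0<a_1<\cdots<a_g<b_g$. The Pell–Abel equation on $C_D$ is the polynomial equation $P^2-DQ^2=c$ with unknowns $P,Q\in\mathbb{C}[x]$ and with $c\in\mathbb{C}^\ast$. The trivial solutions $(P,Q)=(\pm\sqrt{c},0)$ are not considered, i.e. $Q\neq 0$. The degree of a solution $(P,Q)$ is the degree of $P$. A solution is primitive if the degree of $P$ is minimal among all solutions distinct from the trivial ones $(\pm\sqrt{c},0)$.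
   Formalization: The case g = 0, r ≥ 2 is excluded: there the claim is false, since for D of degree 2 with simple zeros the Pell–Abel equation always has a solution of degree 1, so every primitive solution has degree 1. All other pairs (g, r), including (0, 1), are covered. *)

theory Defs
  imports Complex_Main "HOL-Computational_Algebra.Computational_Algebra"
begin

text \<open>
  The curve \<open>y\<^sup>2 = D(x)\<close> of genus \<open>g\<close>, completed by two points at infinity, is represented
  by the polynomial \<open>D\<close>, on which all the notions below depend.
\<close>

definition hyperelliptic :: "nat \<Rightarrow> complex poly \<Rightarrow> bool" where
  "hyperelliptic g D \<longleftrightarrow> degree D = 2 * g + 2 \<and> rsquarefree D"

definition totally_real :: "complex poly \<Rightarrow> bool" where
  "totally_real D \<longleftrightarrow> (\<forall>z. poly D z = 0 \<longrightarrow> z \<in> \<real>)"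

definition pell_abel_solution :: "complex poly \<Rightarrow> complex poly \<Rightarrow> complex poly \<Rightarrow> bool" where
  "pell_abel_solution D P Q \<longleftrightarrow> Q \<noteq> 0 \<and> (\<exists>c. c \<noteq> 0 \<and> P\<^sup>2 - D * Q\<^sup>2 = [:c:])"

definition primitive_solution :: "complex poly \<Rightarrow> complex poly \<Rightarrow> complex poly \<Rightarrow> bool" where
  "primitive_solution D P Q \<longleftrightarrow>
     pell_abel_solution D P Q \<and>
     (\<forall>P' Q'. pell_abel_solution D P' Q' \<longrightarrow> degree P \<le> degree P')"

text \<open>
  Minimality over all constants \<open>c\<close> simultaneously is the same as minimality for one
  fixed constant, since solutions can be rescaled.
\<close>

lemma pell_abel_rescale_constant:
  assumes "pell_abel_solution D P Q" and "c' \<noteq> 0"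
  shows "\<exists>s. s \<noteq> 0 \<and> smult s Q \<noteq> 0 \<and> (smult s P)\<^sup>2 - D * (smult s Q)\<^sup>2 = [:c':]"
proof -
  obtain c where c: "c \<noteq> 0" "P\<^sup>2 - D * Q\<^sup>2 = [:c:]" and Q: "Q \<noteq> 0"
    using assms(1) by (auto simp: pell_abel_solution_def)
  define s where "s = csqrt (c' / c)"
  have s2: "s\<^sup>2 = c' / c" by (simp add: s_def)
  have "s \<noteq> 0" using c assms(2) by (simp add: s_def)
  have "(smult s P)\<^sup>2 - D * (smult s Q)\<^sup>2 = smult (s\<^sup>2) (P\<^sup>2 - D * Q\<^sup>2)"
    by (simp add: power2_eq_square smult_diff_right)
  also have "\<dots> = [:c':]" using c by (simp add: s2)
  finally show ?thesis using \<open>s \<noteq> 0\<close> Q by (intro exI[of _ s]) simp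
qed

text \<open>
  Likewise the leading coefficient of \<open>D\<close> is immaterial, so that one may always take
  \<open>D\<close> monic.
\<close>

lemma primitive_solution_smult:
  assumes "a \<noteq> 0"
  shows "primitive_solution (smult (a\<^sup>2) D) P Q \<longleftrightarrow> primitive_solution D P (smult a Q)"
proof -
  have *: "pell_abel_solution (smult (a\<^sup>2) D) P Q \<longleftrightarrow> pell_abel_solution D P (smult a Q)" for P Q
    using assms by (simp add: pell_abel_solution_def power2_eq_square)
  have "(\<exists>Q. pell_abel_solution (smult (a\<^sup>2) D) P Q) \<longleftrightarrow> (\<exists>Q. pell_abel_solution D P Q)" for P
  proof
    assume "\<exists>Q. pell_abel_solution D P Q"
    then obtain Q where "pell_abel_solution D P Q" by blast
    hence "pell_abel_solution D P (smult a (smult (inverse a) Q))" using assms by simp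
    thus "\<exists>Q. pell_abel_solution (smult (a\<^sup>2) D) P Q" using * by blast
  qed (use * in blast)
  thus ?thesis unfolding primitive_solution_def * by blast
qed

lemma totally_real_normal_form:
  assumes "hyperelliptic g D" and "totally_real D"
  obtains a b :: "nat \<Rightarrow> real"
  where "\<And>i. i \<le> g \<Longrightarrow> a i < b i" and "\<And>i. i < g \<Longrightarrow> b i < a (Suc i)"
    and "D = smult (lead_coeff D)
               (\<Prod>i\<le>g. [:- complex_of_real (a i), 1:] * [:- complex_of_real (b i), 1:])"
proof -
  have D0: "D \<noteq> 0" and sf: "rsquarefree D" and deg: "degree D = 2 * g + 2"
    using assms(1) by (auto simp: hyperelliptic_def)
  define S where "S = {x::real. poly D (of_real x) = 0}"
  have im: "{z. poly D z = 0} = of_real ` S"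
    using assms(2) by (auto simp: totally_real_def S_def Reals_def)
  have fin: "finite S" 
    using poly_roots_finite[OF D0] im by (metis finite_imageD inj_of_real inj_on_subset top_greatest)
  have prod: "D = smult (lead_coeff D) (\<Prod>x\<in>S. [:- of_real x, 1:])"
  proof -
    have "D = smult (lead_coeff D) (\<Prod>z | poly D z = 0. [:-z, 1:])"
      using complex_poly_decompose_rsquarefree[OF sf] by simp
    also have "(\<Prod>z | poly D z = 0. [:-z, 1:]) = (\<Prod>x\<in>S. [:- complex_of_real x, 1:])"
      unfolding im by (subst prod.reindex) (auto simp: inj_on_def)
    finally show ?thesis .
  qed
  have "degree (\<Prod>x\<in>S. [:- complex_of_real x, 1:]) = card S"
    by (subst degree_prod_eq_sum_degree) auto
  hence card: "card S = 2 * g + 2" 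
    using arg_cong[OF prod, of degree] deg by (simp split: if_splits)
  define xs where "xs = sorted_list_of_set S"
  have len: "length xs = 2 * g + 2" and set: "set xs = S" and dis: "distinct xs"
    and srt: "sorted_wrt (<) xs"
    using fin card by (auto simp: xs_def)
  define a where "a i = xs ! (2 * i)" for i
  define b where "b i = xs ! (2 * i + 1)" for i
  show ?thesis
  proof (rule that[of a b])
    show "a i < b i" if "i \<le> g" for i
      unfolding a_def b_def using that len by (intro sorted_wrt_nth_less[OF srt]) auto
    show "b i < a (Suc i)" if "i < g" for i
      unfolding a_def b_def using that len by (intro sorted_wrt_nth_less[OF srt]) auto
    have aux: "(\<Prod>i<2 * n. f i) = (\<Prod>i<n. f (2 * i) * f (2 * i + 1))" 
      for f :: "nat \<Rightarrow> complex poly" and n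
      by (induction n) (auto simp: mult_ac)
    have "(\<Prod>x\<in>S. [:- complex_of_real x, 1:]) = (\<Prod>i<length xs. [:- complex_of_real (xs ! i), 1:])"
      unfolding set[symmetric] 
      by (rule prod.reindex_bij_betw[OF bij_betw_nth[OF dis refl refl], symmetric])
    also have "\<dots> = (\<Prod>i<2 * Suc g. [:- complex_of_real (xs ! i), 1:])" using len by simp
    also have "\<dots> = (\<Prod>i\<le>g. [:- complex_of_real (a i), 1:] * [:- complex_of_real (b i), 1:])"
      unfolding aux lessThan_Suc_atMost a_def b_def ..
    finally show "D = smult (lead_coeff D)
               (\<Prod>i\<le>g. [:- complex_of_real (a i), 1:] * [:- complex_of_real (b i), 1:])" 
      using prod by simp
  qed
qed

text \<open>
  For \<open>g = 0\<close> every curve has a solution of degree 1, for example \<open>x\<^sup>2 - (x\<^sup>2 - 1) \<cdot> 1\<^sup>2 = 1\<close>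
  for \<open>D = x\<^sup>2 - 1\<close>. A criterion \<open>r > g\<close> for primitive solutions of degree \<open>r\<close> is
  therefore false for \<open>g = 0\<close>, \<open>r \<ge> 2\<close>.
\<close>

lemma genus_0_primitive_degree:
  assumes "hyperelliptic 0 D" and "primitive_solution D P Q"
  shows "degree P = 1"
proof -
  have deg: "degree D = 2" and sf: "rsquarefree D" using assms(1) by (auto simp: hyperelliptic_def)
  obtain d b a where D: "D = [:d, b, a:]" and a: "a \<noteq> 0"
  proof -
    have "D = [:coeff D 0, coeff D 1, coeff D 2:]"
      by (rule poly_eqI) (auto simp: coeff_pCons deg coeff_eq_0 numeral_2_eq_2 split: nat.splits)
    moreover have "coeff D 2 \<noteq> 0" using deg by (metis degree_0 leading_coeff_0_iff zero_neq_numeral)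
    ultimately show ?thesis using that by blast
  qed
  define s where "s = inverse (csqrt a)"
  have s: "s\<^sup>2 = 1 / a" unfolding s_def power_inverse by (simp add: divide_inverse)
  define m where "m = b / (2 * a)"
  define c where "c = m\<^sup>2 - d / a"
  have eq: "[:m, 1:]\<^sup>2 - D * [:s:]\<^sup>2 = [:c:]"
    using a by (simp add: D c_def m_def power2_eq_square s[unfolded power2_eq_square])
  have "c \<noteq> 0"
  proof
    assume "c = 0"
    hence "D = smult a ([:m, 1:]\<^sup>2)"
      using a by (simp add: D c_def m_def power2_eq_square field_simps)
    hence "order (-m) D = 2" 
      using a order_power_n_n[of "-m" 2] by (simp add: order_smult)
    thus False using sf by (auto simp: rsquarefree_def dest: spec[of _ "-m"])
  qed
  moreover have "s \<noteq> 0" using a by (simp add: s_def)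
  ultimately have "pell_abel_solution D [:m, 1:] [:s:]"
    using eq by (auto simp: pell_abel_solution_def)
  hence le: "degree P \<le> 1" using assms(2) by (fastforce simp: primitive_solution_def)
  obtain c where Q: "Q \<noteq> 0" and PQ: "P\<^sup>2 - D * Q\<^sup>2 = [:c:]"
    using assms(2) by (auto simp: primitive_solution_def pell_abel_solution_def)
  have "degree P \<noteq> 0"
  proof
    assume "degree P = 0"
    then obtain p where "P = [:p:]" by (rule degree_eq_zeroE)
    moreover have "D * Q\<^sup>2 = P\<^sup>2 - [:c:]" unfolding PQ[symmetric] by simp
    ultimately have "D * Q\<^sup>2 = [:p\<^sup>2 - c:]" by (simp add: power2_eq_square)
    hence "degree (D * Q\<^sup>2) = 0" by simp
    thus False using deg Q by (subst (asm) degree_mult_eq) auto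
  qed
  thus ?thesis using le by simp
qed

corollary genus_0_failure:
  "\<not> (\<forall>g r. r \<ge> 1 \<longrightarrow>
        (\<exists>D. hyperelliptic g D \<and> totally_real D \<and>
              (\<exists>P Q. primitive_solution D P Q \<and> degree P = r)) \<longleftrightarrow> r > g)"
proof
  assume *: "\<forall>g r. r \<ge> 1 \<longrightarrow>
        (\<exists>D. hyperelliptic g D \<and> totally_real D \<and>
              (\<exists>P Q. primitive_solution D P Q \<and> degree P = r)) \<longleftrightarrow> r > g"
  obtain D P Q where "hyperelliptic 0 D" "primitive_solution D P Q" "degree P = 2"
    using *[rule_format, of 2 0] by auto
  thus False using genus_0_primitive_degree[of D P Q] by simp
qed

end

theory Submission
  imports Defs "HOL-Analysis.Analysis" "HOL-Computational_Algebra.Field_as_Ring"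
begin

text \<open>
  If \<open>P\<^sup>2 - D Q\<^sup>2 = c\<close> with \<open>Q \<noteq> 0\<close> then \<open>2 deg P = deg D + 2 deg Q \<ge> 2g + 2\<close>, so \<open>r > g\<close>
  is necessary (\<open>pell_degree\<close>). For sufficiency, put \<open>m = r - g\<close>; one needs a real polynomial \<open>P\<close>
  of degree \<open>r\<close> such that all but \<open>2g + 2\<close> of the zeros of \<open>P\<^sup>2 - 1\<close> pair up to double zeros and
  the remaining ones are real and simple, and one needs \<open>P\<close> not to be a Chebyshev polynomial of a
  smaller solution.

  \<^emph>\<open>Primitivity.\<close> After rescaling to \<open>c = 1\<close>, the solutions form a group under multiplication of
  \<open>P + Q\<surd>D\<close>. Two solutions of equal degree agree up to signs (\<open>pell_same_degree_unique\<close>), and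
  the difference of two degrees is again a degree (\<open>pell_degree_difference\<close>), so every
  solution is, up to signs, a power of one of minimal positive degree. The set where \<open>|P| \<le> 1\<close> is
  a union of \<open>g + 1\<close> bands \<open>[a,b]\<close> whose endpoints are the roots of \<open>D\<close>. If \<open>(P,Q)\<close> is a
  \<open>k\<close>-th power with \<open>k \<ge> 2\<close>, each band is traversed at least \<open>k\<close> times, so that \<open>Q\<close> vanishes inside
  it. Hence a single band which \<open>P\<close> traverses exactly once forces \<open>(P,Q)\<close> to be primitive
  (\<open>pell_simple_band_primitive\<close>). For \<open>g = 0\<close> and \<open>r = 1\<close> the degree count already gives primitivity.

  \<^emph>\<open>Existence.\<close> Fix the zeros \<open>1, \<dots>, g\<close> through the weight \<open>W(x) = (1 - x) \<cdots> (g - x)\<close> and seek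
  \<open>F = W p\<close> with \<open>p\<close> monic of degree \<open>m\<close> that alternates between \<open>\<plusminus>E\<close> at \<open>m + 1\<close> points
  \<open>0 = x\<^sub>0 < \<cdots> < x\<^sub>m = d\<close>, the interior ones being critical points of \<open>F\<close>. Such an \<open>F\<close> comes from the
  choice of nodes for which \<open>E\<close> is largest (\<open>weighted_alternation\<close>). If \<open>d\<close> is small then \<open>E\<close> is
  so small that \<open>|F| > E\<close> at each of \<open>1/2, 3/2, \<dots>, g + 1/2\<close>, so that around each zero \<open>1, \<dots>, g\<close>
  there is a band which \<open>F\<close> crosses once. The interior nodes (double), the two endpoints
  \<open>0\<close>, \<open>d\<close> and the \<open>2g\<close> endpoints of these bands then account for all \<open>2r\<close> zeros of
  \<open>F\<^sup>2 - E\<^sup>2\<close>, and \<open>P = F/E\<close> is the desired solution (\<open>totally_real_pell_exists\<close>).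
\<close>

section \<open>The group of solutions\<close>

text \<open>
  These are the identities behind \<open>(F + G\<surd>D)(F1 \<plusminus> G1\<surd>D)\<close>: the product of solutions is a
  solution, and multiplying the first (or second) components for the two signs cancels all mixed
  terms, leaving a polynomial whose degree is easily bounded.
\<close>
lemma pell_product_identity:
  fixes D F G F1 G1 :: "'a::comm_ring_1"
  assumes "F\<^sup>2 - D * G\<^sup>2 = 1" "F1\<^sup>2 - D * G1\<^sup>2 = 1"
  shows "(F * G1 - F1 * G) * (F * G1 + F1 * G) = G1\<^sup>2 - G\<^sup>2"
    and "(F * F1 - D * G * G1) * (F * F1 + D * G * G1) = F\<^sup>2 + F1\<^sup>2 - 1"
    and "(F * F1 - D * G * G1)\<^sup>2 - D * (F * G1 - F1 * G)\<^sup>2 = 1"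
    and "(F * F1 + D * G * G1)\<^sup>2 - D * (F * G1 + F1 * G)\<^sup>2 = 1"
proof -
  define u v where "u = F * F" and "v = F1 * F1"
  have 1: "F * F = u" "F1 * F1 = v" "D * (G * G) = u - 1" "D * (G1 * G1) = v - 1"
    using assms by (simp_all add: u_def v_def power2_eq_square algebra_simps)
  have "(F * G1 - F1 * G) * (F * G1 + F1 * G) = (F * F) * (G1 * G1) - (F1 * F1) * (G * G)"
    by (simp add: algebra_simps)
  also have "\<dots> = (1 + D * (G * G)) * (G1 * G1) - (1 + D * (G1 * G1)) * (G * G)"
    using 1 by simp
  also have "\<dots> = G1\<^sup>2 - G\<^sup>2" by (simp add: power2_eq_square algebra_simps)
  finally show "(F * G1 - F1 * G) * (F * G1 + F1 * G) = G1\<^sup>2 - G\<^sup>2" .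
  have "(F * F1 - D * G * G1) * (F * F1 + D * G * G1)
      = (F * F) * (F1 * F1) - (D * (G * G)) * (D * (G1 * G1))"
    by (simp add: algebra_simps)
  also have "\<dots> = F\<^sup>2 + F1\<^sup>2 - 1" unfolding 1 by (simp add: algebra_simps power2_eq_square 1)
  finally show "(F * F1 - D * G * G1) * (F * F1 + D * G * G1) = F\<^sup>2 + F1\<^sup>2 - 1" .
  have "(F * F1 - D * G * G1)\<^sup>2 - D * (F * G1 - F1 * G)\<^sup>2 = (F\<^sup>2 - D * G\<^sup>2) * (F1\<^sup>2 - D * G1\<^sup>2)"
    by (simp add: power2_eq_square algebra_simps)
  thus "(F * F1 - D * G * G1)\<^sup>2 - D * (F * G1 - F1 * G)\<^sup>2 = 1" using assms by simp
  have "(F * F1 + D * G * G1)\<^sup>2 - D * (F * G1 + F1 * G)\<^sup>2 = (F\<^sup>2 - D * G\<^sup>2) * (F1\<^sup>2 - D * G1\<^sup>2)"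
    by (simp add: power2_eq_square algebra_simps)
  thus "(F * F1 + D * G * G1)\<^sup>2 - D * (F * G1 + F1 * G)\<^sup>2 = 1" using assms by simp
qed

lemma pell_degree:
  fixes D F G :: "'a::idom poly"
  assumes "F\<^sup>2 - D * G\<^sup>2 = [:c:]" "G \<noteq> 0" "degree D > 0"
  shows "2 * degree F = degree D + 2 * degree G"
proof -
  have "degree (F\<^sup>2) = degree (D * G\<^sup>2 + [:c:])" using assms(1) by (simp add: algebra_simps)
  moreover have "degree (D * G\<^sup>2) = degree D + 2 * degree G"
    using assms by (subst degree_mult_eq) (auto simp: degree_power_eq)
  ultimately show ?thesis
    using assms(3) by (cases "F = 0") (auto simp: degree_power_eq degree_add_eq_left)
qed

lemma pell_zero_iff:
  fixes D F G :: "'a::idom poly"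
  assumes "F\<^sup>2 - D * G\<^sup>2 = 1" "degree D > 0"
  shows "G = 0 \<longleftrightarrow> degree F = 0"
proof
  assume "G = 0"
  hence "F\<^sup>2 = 1" using assms by simp
  hence "degree (F\<^sup>2) = 0" by simp
  thus "degree F = 0" by (cases "F = 0") (auto simp: degree_power_eq)
next
  assume "degree F = 0"
  thus "G = 0" using pell_degree[of F D G 1] assms by (auto simp: one_pCons)
qed

text \<open>
  The factors \<open>F G1 \<plusminus> F1 G\<close> have sum \<open>2 F G1\<close> of degree \<open>deg F + deg G\<close>, while their product
  \<open>G1\<^sup>2 - G\<^sup>2\<close> has degree at most \<open>2 deg G\<close>. As \<open>deg G < deg F\<close>, one of the factors is zero.
\<close>
lemma pell_same_degree_unique:
  fixes D F G F1 G1 :: "'a::{idom,ring_char_0} poly"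
  assumes "F\<^sup>2 - D * G\<^sup>2 = 1" "F1\<^sup>2 - D * G1\<^sup>2 = 1" "degree D > 0"
    and "degree F = degree F1"
  shows "F1\<^sup>2 = F\<^sup>2" "G1\<^sup>2 = G\<^sup>2"
proof -
  show *: "G1\<^sup>2 = G\<^sup>2"
  proof (cases "degree F = 0")
    case True
    hence "G = 0" "G1 = 0" using pell_zero_iff assms by metis+
    thus ?thesis by simp
  next
    case False
    hence nz: "G \<noteq> 0" "G1 \<noteq> 0" using pell_zero_iff assms by metis+
    have F0: "F \<noteq> 0" using False by auto
    have d: "degree F > degree G" "degree G1 = degree G"
      using pell_degree[of F D G 1] pell_degree[of F1 D G1 1] assms nz by (auto simp: one_pCons)
    let ?X = "F * G1 - F1 * G" and ?Y = "F * G1 + F1 * G"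
    have eq: "?X * ?Y = G1\<^sup>2 - G\<^sup>2" using pell_product_identity(1)[OF assms(1,2)] .
    show ?thesis
    proof (rule ccontr)
      assume "G1\<^sup>2 \<noteq> G\<^sup>2"
      hence XY: "?X \<noteq> 0" "?Y \<noteq> 0" using eq by auto
      have "degree (smult 2 (F * G1)) = degree F + degree G"
        using F0 nz d by (simp add: degree_mult_eq)
      moreover have "smult 2 (F * G1) = ?X + ?Y" by (simp add: numeral_poly)
      ultimately have "degree F + degree G \<le> max (degree ?X) (degree ?Y)"
        by (metis degree_add_le_max)
      also have "\<dots> \<le> degree ?X + degree ?Y" by simp
      also have "\<dots> = degree (?X * ?Y)" using XY by (simp add: degree_mult_eq)
      also have "\<dots> \<le> 2 * degree G" unfolding eq
        by (rule degree_diff_le) (use nz d in \<open>auto simp: degree_power_eq\<close>)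
      finally show False using d by simp
    qed
  qed
  from assms(1,2) have "F\<^sup>2 = 1 + D * G\<^sup>2" "F1\<^sup>2 = 1 + D * G1\<^sup>2" by (simp_all add: algebra_simps)
  thus "F1\<^sup>2 = F\<^sup>2" using * by simp
qed

text \<open>
  Dividing by a solution of smaller degree. Of the two quotients \<open>(F + G\<surd>D)(F1 \<plusminus> G1\<surd>D)\<close> one
  has degree \<open>deg F + deg F1\<close>; since the product of the first components is
  \<open>F\<^sup>2 + F1\<^sup>2 - 1\<close>, of degree \<open>2 deg F\<close>, the other has the difference as its degree.
\<close>
lemma pell_degree_difference:
  fixes D F G F1 G1 :: "'a::{idom,ring_char_0} poly"
  assumes "F\<^sup>2 - D * G\<^sup>2 = 1" "F1\<^sup>2 - D * G1\<^sup>2 = 1" "degree D > 0"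
    and "0 < degree F1" "degree F1 < degree F"
  shows "\<exists>F2 G2. F2\<^sup>2 - D * G2\<^sup>2 = 1 \<and> degree F2 = degree F - degree F1"
proof -
  have nz: "G \<noteq> 0" "G1 \<noteq> 0" "F \<noteq> 0" "F1 \<noteq> 0" "D \<noteq> 0"
    using pell_zero_iff assms by (metis not_less0, metis not_less0, auto)
  let ?X = "F * F1 - D * G * G1" and ?Y = "F * F1 + D * G * G1"
  have dD: "degree (D * G * G1) = degree F + degree F1"
    using pell_degree[of F D G 1] pell_degree[of F1 D G1 1] assms nz
    by (auto simp: one_pCons degree_mult_eq)
  have dF: "degree (F * F1) = degree F + degree F1" using nz by (simp add: degree_mult_eq)
  have le: "degree ?X \<le> degree F + degree F1" "degree ?Y \<le> degree F + degree F1"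
    using dD dF by (auto intro: degree_diff_le degree_add_le)
  have "degree (F1\<^sup>2 - 1) < degree (F\<^sup>2)"
    using assms nz by (intro le_less_trans[OF degree_diff_le_max]) (auto simp: degree_power_eq)
  hence "degree (F\<^sup>2 + (F1\<^sup>2 - 1)) = 2 * degree F"
    using nz by (subst degree_add_eq_left) (auto simp: degree_power_eq)
  hence dXY: "degree (?X * ?Y) = 2 * degree F"
    unfolding pell_product_identity(2)[OF assms(1,2)] by (simp add: algebra_simps)
  hence "?X \<noteq> 0" "?Y \<noteq> 0" using assms(5) by auto
  hence sum: "degree ?X + degree ?Y = 2 * degree F" using dXY by (simp add: degree_mult_eq)
  have "degree (smult 2 (F * F1)) = degree F + degree F1"
    using dF by simp
  moreover have "smult 2 (F * F1) = ?X + ?Y" by (simp add: numeral_poly)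
  ultimately have "degree F + degree F1 \<le> max (degree ?X) (degree ?Y)"
    by (metis degree_add_le_max)
  hence "degree ?X = degree F - degree F1 \<or> degree ?Y = degree F - degree F1"
    using le sum by linarith
  thus ?thesis using pell_product_identity(3,4)[OF assms(1,2)] by blast
qed

lemma pell_minimal_degree_dvd:
  fixes D F1 G1 :: "'a::{idom,ring_char_0} poly"
  assumes "F1\<^sup>2 - D * G1\<^sup>2 = 1" "degree D > 0" "0 < degree F1"
    and min: "\<And>F G. F\<^sup>2 - D * G\<^sup>2 = 1 \<Longrightarrow> 0 < degree F \<Longrightarrow> degree F1 \<le> degree F"
  shows "F\<^sup>2 - D * G\<^sup>2 = 1 \<Longrightarrow> degree F1 dvd degree F"
proof (induction "degree F" arbitrary: F G rule: less_induct)
  case less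
  consider "degree F = 0" | "degree F = degree F1" | "degree F1 < degree F"
    using min[OF less.prems] by linarith
  thus ?case
  proof cases
    case 3
    then obtain F2 G2 where *: "F2\<^sup>2 - D * G2\<^sup>2 = 1" "degree F2 = degree F - degree F1"
      using pell_degree_difference[OF less.prems assms(1-3)] by blast
    have "degree F1 dvd degree F2" using less.hyps[OF _ *(1)] * 3 assms(3) by simp
    thus ?thesis using * 3 by (metis dvd_diffD dvd_refl less_imp_le)
  qed auto
qed

text \<open>
  \<open>pell_power D F G k\<close> consists of the coefficients of \<open>(F + G\<surd>D)^k\<close>, that is of the
  Chebyshev polynomials \<open>T\<^sub>k(F)\<close> and \<open>G U\<^sub>k\<^sub>-\<^sub>1(F)\<close>.
\<close>
fun pell_power :: "'a::comm_ring_1 poly \<Rightarrow> 'a poly \<Rightarrow> 'a poly \<Rightarrow> nat \<Rightarrow> 'a poly \<times> 'a poly" where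
  "pell_power D F G 0 = (1, 0)"
| "pell_power D F G (Suc k) =
     (let (A, B) = pell_power D F G k in (F * A + D * G * B, F * B + G * A))"

lemma pell_power_solution:
  assumes "F\<^sup>2 - D * G\<^sup>2 = 1"
  shows "(fst (pell_power D F G k))\<^sup>2 - D * (snd (pell_power D F G k))\<^sup>2 = 1"
proof (induction k)
  case (Suc k)
  show ?case using pell_product_identity(4)[OF assms Suc]
    by (simp add: split_def Let_def algebra_simps)
qed simp

text \<open>
  Leading terms of \<open>F A\<close> and \<open>D G B\<close> might cancel a priori; the Chebyshev three-term recursion
  shows that they do not.
\<close>
lemma pell_power_degree:
  fixes D F G :: "'a::{idom,ring_char_0} poly"
  assumes "F\<^sup>2 - D * G\<^sup>2 = 1" "0 < degree F"
  shows "degree (fst (pell_power D F G k)) = k * degree F"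
proof -
  define A where "A k = fst (pell_power D F G k)" for k
  define B where "B k = snd (pell_power D F G k)" for k
  have A0: "A 0 = 1" "A (Suc 0) = F" by (simp_all add: A_def)
  have AS: "A (Suc k) = F * A k + D * G * B k" "B (Suc k) = F * B k + G * A k" for k
    by (simp_all add: A_def B_def split_def Let_def)
  have FF: "F * F = 1 + D * G * G" using assms by (simp add: power2_eq_square algebra_simps)
  have rec: "A (Suc (Suc k)) = smult 2 (F * A (Suc k)) - A k" for k
  proof -
    have "A (Suc (Suc k)) = 2 * F * A (Suc k) - A k"
      unfolding AS using FF by algebra
    thus ?thesis by (simp add: numeral_poly)
  qed
  have F0: "F \<noteq> 0" using assms by auto
  have "degree (A k) = k * degree F \<and> degree (A (Suc k)) = Suc k * degree F"
  proof (induction k)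
    case (Suc k)
    have "A (Suc k) \<noteq> 0" using Suc assms(2) by auto
    hence d: "degree (smult 2 (F * A (Suc k))) = degree F + Suc k * degree F"
      using Suc F0 by (simp add: degree_mult_eq)
    have "degree (A (Suc (Suc k))) = degree (smult 2 (F * A (Suc k)) + (- A k))"
      unfolding rec by simp
    also have "\<dots> = degree F + Suc k * degree F"
      using d Suc assms(2) by (subst degree_add_eq_left) auto
    finally show ?case using Suc by simp
  qed (simp_all add: A0)
  thus ?thesis by (simp add: A_def)
qed

lemma pell_power_at_root:
  assumes "poly D x = 0"
  shows "poly (fst (pell_power D F G k)) x = poly F x ^ k"
  using assms by (induction k) (simp_all add: split_def Let_def)

text \<open>
  The Chebyshev parametrization. It is used at \<open>t = \<pi>/k\<close>, where it exhibits a zero of the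
  second component.
\<close>
lemma pell_power_cos:
  fixes D F G :: "complex poly" and t :: complex
  assumes "F\<^sup>2 - D * G\<^sup>2 = 1" "poly F x = cos t" "sin t \<noteq> 0"
  shows "poly (fst (pell_power D F G k)) x = cos (of_nat k * t) \<and>
    poly (snd (pell_power D F G k)) x * sin t = poly G x * sin (of_nat k * t)"
proof (induction k)
  case (Suc k)
  define A B where "A = poly (fst (pell_power D F G k)) x" and "B = poly (snd (pell_power D F G k)) x"
  define d y where "d = poly D x" and "y = poly G x"
  define C S where "C = cos (of_nat k * t)" and "S = sin (of_nat k * t)"
  have IH: "A = C" "B * sin t = y * S"
    using Suc unfolding A_def B_def C_def S_def y_def by auto
  have "poly (F\<^sup>2 - D * G\<^sup>2) x = 1" using assms by simp
  hence DG: "d * y * y = - (sin t * sin t)"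
    using assms(2) sin_cos_squared_add[of t] unfolding d_def y_def
    by (simp add: power2_eq_square algebra_simps eq_neg_iff_add_eq_0)
  have "(cos t * A + d * y * B) * sin t = (cos t * C - sin t * S) * sin t"
    using DG IH by algebra
  hence 1: "cos t * A + d * y * B = cos t * C - sin t * S" using assms(3) by simp
  have 2: "(cos t * B + y * A) * sin t = y * (sin t * C + cos t * S)"
    using DG IH by algebra
  have 3: "of_nat (Suc k) * t = t + of_nat k * t" by (simp add: algebra_simps)
  show ?case unfolding 3 cos_add sin_add
    using 1 2 unfolding A_def B_def C_def S_def d_def y_def
    by (simp add: split_def Let_def assms)
qed simp

text \<open>
  The conjugate of a solution is a solution of the same degree, hence equal to it up to sign;
  one nonzero real value excludes the sign \<open>-1\<close>.
\<close>
lemma pell_real_of_real_value: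
  fixes D F G :: "complex poly"
  assumes sol: "F\<^sup>2 - D * G\<^sup>2 = 1" "degree D > 0"
    and D: "map_poly cnj D = D"
    and x: "poly F (of_real x) \<in> \<real>" "poly F (of_real x) \<noteq> 0"
  shows "poly F (of_real y) \<in> \<real>"
proof -
  let ?F = "map_poly cnj F" and ?G = "map_poly cnj G"
  have "poly (?F\<^sup>2 - D * ?G\<^sup>2) z = 1" for z
  proof -
    have "poly (?F\<^sup>2 - D * ?G\<^sup>2) z = poly (?F\<^sup>2 - map_poly cnj D * ?G\<^sup>2) z" by (simp only: D)
    also have "\<dots> = cnj (poly (F\<^sup>2 - D * G\<^sup>2) (cnj z))" by simp
    finally show ?thesis using sol by simp
  qed
  hence "poly (?F\<^sup>2 - D * ?G\<^sup>2) = poly 1" by (intro ext) simp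
  hence sol': "?F\<^sup>2 - D * ?G\<^sup>2 = 1" by (simp only: poly_eq_poly_eq_iff)
  have "degree ?F = degree F" by (rule degree_map_poly) auto
  hence "F\<^sup>2 = ?F\<^sup>2" using pell_same_degree_unique(1)[OF sol' sol(1,2)] by simp
  hence "F = ?F \<or> F = - ?F" by (simp add: power2_eq_iff)
  moreover have "F \<noteq> - ?F"
  proof
    assume "F = - ?F"
    hence "poly F (of_real x) = poly (- ?F) (of_real x)" by (rule arg_cong)
    also have "\<dots> = - cnj (poly F (of_real x))" by simp
    also have "cnj (poly F (of_real x)) = poly F (of_real x)" using x(1) by (simp add: Reals_cnj_iff)
    finally show False using x(2) by simp
  qed
  ultimately have "F = ?F" by blast
  hence "poly F (of_real y) = poly ?F (of_real y)" by (rule arg_cong)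
  also have "\<dots> = cnj (poly F (of_real y))" by simp
  finally show ?thesis by (simp add: Reals_cnj_iff)
qed

text \<open>
  Suppose \<open>P = \<plusminus>T\<^sub>k(F)\<close> with \<open>k \<ge> 2\<close>. The polynomial \<open>F\<close> is real, and at
  the ends of the band it is \<open>\<plusminus>1\<close>, with different signs because \<open>P\<close> takes different values there.
  So \<open>F\<close> passes through \<open>cos(\<pi>/k)\<close>, and there \<open>Q\<close> vanishes.
\<close>
lemma pell_simple_band_primitive:
  fixes D P Q :: "complex poly" and a b :: real
  assumes sol: "P\<^sup>2 - D * Q\<^sup>2 = 1" and degs: "degree D > 0" "degree P > 0"
    and D: "map_poly cnj D = D"
    and ab: "a < b" "poly D (of_real a) = 0" "poly D (of_real b) = 0"
    and Q: "\<And>x. a < x \<Longrightarrow> x < b \<Longrightarrow> poly Q (of_real x) \<noteq> 0"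
    and P: "poly P (of_real a) \<noteq> poly P (of_real b)"
  shows "primitive_solution D P Q"
proof -
  define S where "S F \<longleftrightarrow> (\<exists>G. F\<^sup>2 - D * G\<^sup>2 = 1 \<and> 0 < degree F)" for F
  have "S P" unfolding S_def using sol degs by blast
  then obtain F where F: "S F" and F_min: "\<And>F'. S F' \<Longrightarrow> degree F \<le> degree F'"
    using ex_has_least_nat[of S P degree] by blast
  from F obtain G where FG: "F\<^sup>2 - D * G\<^sup>2 = 1" "0 < degree F" unfolding S_def by blast
  have min: "degree F \<le> degree F'" if "F'\<^sup>2 - D * G'\<^sup>2 = 1" "0 < degree F'" for F' G'
    using F_min[of F'] that unfolding S_def by blast
  have "degree F dvd degree P"
    using pell_minimal_degree_dvd[OF FG(1) degs(1) FG(2) _ sol] min by blast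
  then obtain k where k: "degree P = degree F * k" by (rule dvdE)
  define A B where "A = fst (pell_power D F G k)" and "B = snd (pell_power D F G k)"
  have AB: "A\<^sup>2 - D * B\<^sup>2 = 1" unfolding A_def B_def by (rule pell_power_solution[OF FG(1)])
  have dA: "degree P = degree A"
    using pell_power_degree[OF FG, of k] k by (simp add: A_def mult.commute)
  have PA: "A\<^sup>2 = P\<^sup>2" "B\<^sup>2 = Q\<^sup>2" using pell_same_degree_unique[OF sol AB degs(1) dA] .
  have "k = 1"
  proof (rule ccontr)
    assume "k \<noteq> 1"
    hence k2: "k \<ge> 2" using k degs by (cases k) auto
    have unit: "poly F (of_real c) = 1 \<or> poly F (of_real c) = -1" if "poly D (of_real c) = 0" for c
    proof -
      have "poly (F\<^sup>2 - D * G\<^sup>2) (of_real c) = 1" using FG by simp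
      thus ?thesis using that by (simp add: power2_eq_1_iff)
    qed
    have real: "poly F (of_real y) \<in> \<real>" for y
      using unit[OF ab(2)] pell_real_of_real_value[OF FG(1) degs(1) D, of a] by auto
    have ne: "poly F (of_real a) \<noteq> poly F (of_real b)"
    proof
      assume "poly F (of_real a) = poly F (of_real b)"
      hence "poly A (of_real a) = poly A (of_real b)"
        unfolding A_def pell_power_at_root[OF ab(2)] pell_power_at_root[OF ab(3)] by simp
      moreover have "A = P \<or> A = -P" using PA by (simp add: power2_eq_iff)
      ultimately show False using P by auto
    qed
    define t where "t = pi / real k"
    have t: "0 < t" "t < pi" "real k * t = pi" using k2 by (auto simp: t_def field_simps)
    have sin_t: "sin t > 0" using t by (intro sin_gt_zero) auto
    have cos_t: "-1 < cos t" "cos t < 1"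
      using cos_monotone_0_pi[of 0 t] cos_monotone_0_pi[of t pi] t by auto
    define f where "f x = Re (poly F (of_real x))" for x :: real
    have F_eq: "poly F (of_real x) = of_real (f x)" for x
      using real[of x] by (simp add: f_def)
    have cont: "continuous_on {a..b} f" unfolding f_def by (intro continuous_intros)
    have f_ab: "f a = 1 \<and> f b = -1 \<or> f a = -1 \<and> f b = 1"
      using unit[OF ab(2)] unit[OF ab(3)] ne by (auto simp: f_def)
    have "\<exists>x\<ge>a. x \<le> b \<and> f x = cos t"
    proof (cases "f a = 1")
      case True
      thus ?thesis using IVT2'[of f b "cos t" a] f_ab cos_t ab(1) cont by auto
    next
      case False
      thus ?thesis using IVT'[of f a "cos t" b] f_ab cos_t ab(1) cont by auto
    qed
    then obtain x where x: "a \<le> x" "x \<le> b" "f x = cos t" by blast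
    have "x \<noteq> a" "x \<noteq> b" using x(3) f_ab cos_t by auto
    hence x': "a < x" "x < b" using x by auto
    have "poly F (of_real x) = cos (of_real t)" using F_eq x by (simp add: cos_of_real)
    moreover have st: "sin (of_real t :: complex) \<noteq> 0" using sin_t by (simp add: sin_of_real)
    ultimately have "poly B (of_real x) * sin (of_real t) = poly G (of_real x) * sin (of_nat k * of_real t)"
      unfolding B_def using pell_power_cos[OF FG(1)] by blast
    also have "of_nat k * of_real t = (of_real (real k * t) :: complex)" by simp
    also have "sin \<dots> = 0" unfolding t(3) sin_of_real by simp
    finally have "poly B (of_real x) = 0" using st by simp
    hence "poly (B\<^sup>2) (of_real x) = 0" by simp
    thus False using Q[OF x'] PA by simp
  qed
  have "Q \<noteq> 0" using pell_zero_iff[OF sol degs(1)] degs(2) by auto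
  hence "pell_abel_solution D P Q" using sol by (auto simp: pell_abel_solution_def one_pCons)
  moreover have "degree P \<le> degree P'" if sol': "pell_abel_solution D P' Q'" for P' Q'
  proof -
    obtain s where s: "s \<noteq> 0" "smult s Q' \<noteq> 0" "(smult s P')\<^sup>2 - D * (smult s Q')\<^sup>2 = 1"
      using pell_abel_rescale_constant[OF sol', of 1] by (auto simp: one_pCons)
    hence "degree (smult s P') > 0" using pell_zero_iff[OF s(3) degs(1)] by simp
    from min[OF s(3) this] s(1) k \<open>k = 1\<close> show ?thesis by simp
  qed
  ultimately show ?thesis by (auto simp: primitive_solution_def)
qed

section \<open>Weighted polynomials with equal alternating values\<close>

definition node_prod :: "(nat \<Rightarrow> real) \<Rightarrow> nat \<Rightarrow> nat \<Rightarrow> real" where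
  "node_prod x m i = (\<Prod>j\<in>{..m} - {i}. x i - x j)"

lemma lagrange_interpolation:
  assumes inj: "inj_on x {..m}"
  shows "\<exists>p. degree p \<le> m \<and> (\<forall>i\<le>m. poly p (x i) = v i) \<and>
    coeff p m = (\<Sum>i\<le>m. v i / node_prod x m i) \<and>
    (\<forall>y. poly p y = (\<Sum>i\<le>m. v i / node_prod x m i * (\<Prod>j\<in>{..m} - {i}. y - x j)))"
proof -
  define L where "L i = (\<Prod>j\<in>{..m} - {i}. [:- x j, 1:])" for i
  define p where "p = (\<Sum>i\<le>m. smult (v i / node_prod x m i) (L i))"
  have deg_L: "degree (L i) = m" if "i \<le> m" for i
    unfolding L_def using that by (subst degree_prod_eq_sum_degree) auto
  have coeff_L: "coeff (L i) m = 1" if "i \<le> m" for i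
  proof -
    have "lead_coeff (L i) = 1" unfolding L_def by (subst lead_coeff_prod) auto
    thus ?thesis using deg_L[OF that] by simp
  qed
  have poly_p: "poly p y = (\<Sum>i\<le>m. v i / node_prod x m i * (\<Prod>j\<in>{..m} - {i}. y - x j))" for y
    by (simp add: p_def L_def poly_sum poly_prod)
  have "degree p \<le> m" unfolding p_def
    by (intro degree_sum_le order.trans[OF degree_smult_le]) (auto simp: deg_L)
  moreover have "coeff p m = (\<Sum>i\<le>m. v i / node_prod x m i)"
    by (simp add: p_def coeff_sum coeff_L)
  moreover have "poly p (x i) = v i" if "i \<le> m" for i
  proof -
    have nz: "node_prod x m i \<noteq> 0"
      using inj that by (auto simp: node_prod_def inj_on_def)
    have "(\<Prod>j\<in>{..m} - {k}. x i - x j) = 0" if "k \<noteq> i" "k \<le> m" for k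
      using \<open>i \<le> m\<close> that by (intro prod_zero) auto
    hence "poly p (x i) = (\<Sum>k\<le>m. if k = i then v i / node_prod x m i * node_prod x m i else 0)"
      unfolding poly_p by (intro sum.cong) (auto simp: node_prod_def)
    thus ?thesis using that nz by simp
  qed
  ultimately show ?thesis using poly_p by blast
qed

text \<open>
  The leading coefficient as a divided difference: this is what ties the deviation \<open>E\<close> of
  an alternating monic polynomial to its nodes.
\<close>
lemma coeff_eq_divided_difference:
  assumes inj: "inj_on x {..m}" and q: "degree q \<le> m"
  shows "coeff q m = (\<Sum>i\<le>m. poly q (x i) / node_prod x m i)"
proof -
  obtain p where p: "degree p \<le> m" "\<forall>i\<le>m. poly p (x i) = poly q (x i)"
    "coeff p m = (\<Sum>i\<le>m. poly q (x i) / node_prod x m i)"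
    using lagrange_interpolation[OF inj, of "\<lambda>i. poly q (x i)"] by blast
  have "card (x ` {..m}) = Suc m" using inj by (simp add: card_image)
  hence "p = q" using p q by (intro poly_eqI_degree[of "x ` {..m}"]) auto
  thus ?thesis using p by simp
qed

definition node_tuples :: "nat \<Rightarrow> real \<Rightarrow> (nat \<Rightarrow> real) set" where
  "node_tuples m d = {x. x 0 = 0 \<and> x m = d \<and> (\<forall>i<m. x i < x (Suc i))}"

lemma node_tuples_less:
  assumes "x \<in> node_tuples m d" "i < j" "j \<le> m"
  shows "x i < x j"
  using assms(2,3)
proof (induction j)
  case (Suc j)
  have "x j < x (Suc j)" using assms Suc by (auto simp: node_tuples_def)
  thus ?case using Suc by (cases "i = j") auto
qed simp

lemma node_tuples_inj: "x \<in> node_tuples m d \<Longrightarrow> inj_on x {..m}"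
  by (rule inj_onI, rule ccontr) (metis atMost_iff node_tuples_less less_irrefl linorder_neqE_nat)

lemma node_tuples_bounds:
  assumes "x \<in> node_tuples m d" "i \<le> m"
  shows "0 \<le> x i" "x i \<le> d"
  using node_tuples_less[OF assms(1), of 0 i] node_tuples_less[OF assms(1), of i m] assms
  by (cases "i = 0"; cases "i = m"; force simp: node_tuples_def)+

lemma node_prod_sign:
  assumes "x \<in> node_tuples m d" "i \<le> m"
  shows "(-1) ^ (m - i) * node_prod x m i = \<bar>node_prod x m i\<bar>" "\<bar>node_prod x m i\<bar> > 0"
proof -
  have s: "{..m} - {i} = {..<i} \<union> {i<..m}" using assms by auto
  have "node_prod x m i = (\<Prod>j<i. x i - x j) * (\<Prod>j\<in>{i<..m}. x i - x j)"
    unfolding node_prod_def s by (rule prod.union_disjoint) auto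
  also have "(\<Prod>j\<in>{i<..m}. x i - x j) = (\<Prod>j\<in>{i<..m}. (-1) * (x j - x i))" by simp
  also have "\<dots> = (-1) ^ (m - i) * (\<Prod>j\<in>{i<..m}. x j - x i)"
    unfolding prod.distrib by simp
  finally have eq: "node_prod x m i = (-1) ^ (m - i) * ((\<Prod>j<i. x i - x j) * (\<Prod>j\<in>{i<..m}. x j - x i))"
    by simp
  have pos: "(\<Prod>j<i. x i - x j) * (\<Prod>j\<in>{i<..m}. x j - x i) > 0"
    using node_tuples_less[OF assms(1)] assms(2) by (intro mult_pos_pos prod_pos) auto
  define R where "R = (\<Prod>j<i. x i - x j) * (\<Prod>j\<in>{i<..m}. x j - x i)"
  have "node_prod x m i = (-1) ^ (m - i) * R" "R > 0" using eq pos by (auto simp: R_def)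
  thus "(-1) ^ (m - i) * node_prod x m i = \<bar>node_prod x m i\<bar>" "\<bar>node_prod x m i\<bar> > 0"
    by (auto simp: abs_mult power_abs simp flip: power_mult_distrib mult.assoc)
qed

text \<open>
  If \<open>p\<close> is monic of degree \<open>m\<close> and \<open>w p\<close> takes the values \<open>\<plusminus>E\<close> alternately at the nodes \<open>x\<close>,
  then by the divided difference formula \<open>E\<close> is the reciprocal of this sum.
\<close>
definition inverse_deviation :: "(real \<Rightarrow> real) \<Rightarrow> nat \<Rightarrow> (nat \<Rightarrow> real) \<Rightarrow> real" where
  "inverse_deviation w m x = (\<Sum>i\<le>m. 1 / (w (x i) * \<bar>node_prod x m i\<bar>))"

lemma node_prod_le:
  assumes x: "x \<in> node_tuples m d" and "i \<le> m" "k \<le> m" "k \<noteq> i"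
  shows "\<bar>node_prod x m i\<bar> \<le> \<bar>x i - x k\<bar> * d ^ (m - 1)"
proof -
  have "\<bar>node_prod x m i\<bar> = (\<Prod>j\<in>{..m} - {i}. \<bar>x i - x j\<bar>)"
    by (simp add: node_prod_def abs_prod)
  also have "\<dots> = \<bar>x i - x k\<bar> * (\<Prod>j\<in>{..m} - {i} - {k}. \<bar>x i - x j\<bar>)"
    using assms by (subst prod.remove[of _ k]) auto
  also have "(\<Prod>j\<in>{..m} - {i} - {k}. \<bar>x i - x j\<bar>) \<le> (\<Prod>j\<in>{..m} - {i} - {k}. d)"
  proof (intro prod_mono conjI)
    fix j assume "j \<in> {..m} - {i} - {k}"
    thus "\<bar>x i - x j\<bar> \<le> d"
      using node_tuples_bounds[OF x, of i] node_tuples_bounds[OF x, of j] assms by auto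
  qed simp
  also have "\<dots> = d ^ (m - 1)" using assms by (simp add: card_Diff_subset)
  finally show ?thesis by (simp add: mult_left_mono)
qed

lemma compact_box: "compact {x :: nat \<Rightarrow> real. \<forall>i. x i \<in> {a..b}}"
proof -
  have "compactin (product_topology (\<lambda>i::nat. euclidean :: real topology) UNIV) (PiE UNIV (\<lambda>i. {a..b}))"
    by (simp add: compactin_PiE)
  moreover have "PiE UNIV (\<lambda>i::nat. {a..b}) = {x. \<forall>i. x i \<in> {a..b}}" by auto
  ultimately show ?thesis by (simp add: euclidean_product_topology)
qed

text \<open>
  The sum blows up when neighbouring nodes collide, so its infimum may be taken over the
  compact set of tuples whose gaps are bounded below. Tuples are functions on all natural
  numbers, so the coordinates beyond \<open>m\<close> must be confined to an interval as well.
\<close>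
lemma optimal_nodes:
  assumes m: "m \<ge> 1" and d: "d > 0" and w: "continuous_on {0..d} w" "\<And>t. t \<in> {0..d} \<Longrightarrow> w t > 0"
  obtains x where "x \<in> node_tuples m d" "\<And>y. y \<in> node_tuples m d \<Longrightarrow> inverse_deviation w m x \<le> inverse_deviation w m y"
proof -
  define x0 where "x0 i = d * real (min i m) / real m" for i
  have x0: "x0 \<in> node_tuples m d" using m d by (auto simp: node_tuples_def x0_def field_simps)
  define S0 where "S0 = inverse_deviation w m x0"
  have term_pos: "1 / (w (x i) * \<bar>node_prod x m i\<bar>) > 0" if "x \<in> node_tuples m d" "i \<le> m" for x i
    using w(2)[of "x i"] node_tuples_bounds[OF that] node_prod_sign(2)[OF that] by simp
  have "S0 > 0" unfolding S0_def inverse_deviation_def using term_pos[OF x0] by (intro sum_pos) auto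
  obtain t0 where "t0 \<in> {0..d}" "\<forall>t\<in>{0..d}. w t \<le> w t0"
    using continuous_attains_sup[OF compact_Icc _ w(1)] d by auto
  then obtain M where M: "M > 0" "\<And>t. t \<in> {0..d} \<Longrightarrow> w t \<le> M" using w(2) by blast
  \<comment> \<open>the second bound makes a single term next to a gap below \<open>e\<close> at least the whole sum at equidistant nodes\<close>
  define e where "e = min (d / real m) (1 / (M * d ^ (m - 1) * S0))"
  have e: "e > 0" "e \<le> d / real m" "e \<le> 1 / (M * d ^ (m - 1) * S0)"
    using m d M \<open>S0 > 0\<close> by (auto simp: e_def)
  define K where "K = {x. \<forall>i. x i \<in> {0..d}} \<inter> {x. x 0 = 0 \<and> x m = d \<and> (\<forall>i<m. e \<le> x (Suc i) - x i)}"
  have K_nodes: "x \<in> node_tuples m d" if "x \<in> K" for x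
    using that e(1) unfolding K_def node_tuples_def by force
  have "closed {x :: nat \<Rightarrow> real. x 0 = 0 \<and> x m = d \<and> (\<forall>i<m. e \<le> x (Suc i) - x i)}"
    by (intro closed_Collect_conj closed_Collect_eq closed_Collect_all closed_Collect_imp
          closed_Collect_le open_Collect_const continuous_intros continuous_on_product_coordinates)
  hence "compact K" unfolding K_def by (intro compact_Int_closed compact_box)
  moreover have "x0 \<in> K"
  proof -
    have "x0 i \<in> {0..d}" for i using d m by (auto simp: x0_def field_simps)
    moreover have "x0 (Suc i) - x0 i = d / m" if "i < m" for i
      using that m by (simp add: x0_def min_def field_simps)
    ultimately show ?thesis using x0 e(2) by (auto simp: K_def node_tuples_def)
  qed
  moreover have "continuous_on K (inverse_deviation w m)"
  proof -
    have wc: "continuous_on K (\<lambda>x. w (x i))" if "i \<le> m" for i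
      by (rule continuous_on_compose2[OF w(1)])
         (auto intro!: continuous_on_product_coordinates[THEN continuous_on_subset] simp: K_def)
    have nz: "w (x i) * \<bar>\<Prod>j\<in>{..m} - {i}. x i - x j\<bar> \<noteq> 0" if "i \<le> m" "x \<in> K" for i x
      using term_pos[OF K_nodes[OF that(2)] that(1)] unfolding node_prod_def
      by (metis div_by_0 less_irrefl)
    have pc: "continuous_on K (\<lambda>x. x i)" for i
      by (rule continuous_on_subset[OF continuous_on_product_coordinates]) auto
    have "continuous_on K (\<lambda>x. 1 / (w (x i) * \<bar>\<Prod>j\<in>{..m} - {i}. x i - x j\<bar>))" if "i \<le> m" for i
    proof (rule continuous_on_divide)
      show "continuous_on K (\<lambda>x. w (x i) * \<bar>\<Prod>j\<in>{..m} - {i}. x i - x j\<bar>)"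
        by (intro continuous_on_mult continuous_on_rabs continuous_on_prod continuous_on_diff wc pc that)
      show "\<forall>x\<in>K. w (x i) * \<bar>\<Prod>j\<in>{..m} - {i}. x i - x j\<bar> \<noteq> 0" using nz[OF that] by blast
    qed simp
    thus ?thesis unfolding inverse_deviation_def node_prod_def by (intro continuous_on_sum) simp
  qed
  ultimately obtain x where x: "x \<in> K" "\<And>y. y \<in> K \<Longrightarrow> inverse_deviation w m x \<le> inverse_deviation w m y"
    using continuous_attains_inf[of K "inverse_deviation w m"] by auto
  show ?thesis
  proof (rule that[OF K_nodes[OF x(1)]])
    fix y assume y: "y \<in> node_tuples m d"
    show "inverse_deviation w m x \<le> inverse_deviation w m y"
    proof (cases "\<forall>i<m. e \<le> y (Suc i) - y i")
      case True
      define z where "z i = y (min i m)" for i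
      have "inverse_deviation w m y = inverse_deviation w m z"
        unfolding inverse_deviation_def node_prod_def by (intro sum.cong) (auto simp: z_def intro!: prod.cong)
      moreover have "z \<in> K"
        using True y node_tuples_bounds[OF y] by (auto simp: K_def z_def node_tuples_def)
      ultimately show ?thesis using x(2) by simp
    next
      case False
      then obtain i where i: "i < m" "y (Suc i) - y i < e" by auto
      have yi: "y i < y (Suc i)" using y i by (auto simp: node_tuples_def)
      have im: "i \<le> m" using i by simp
      let ?t = "w (y i) * \<bar>node_prod y m i\<bar>"
      have "?t > 0" using term_pos[OF y im] by (simp add: zero_less_mult_iff)
      have "\<bar>node_prod y m i\<bar> \<le> \<bar>y i - y (Suc i)\<bar> * d ^ (m - 1)"
        by (rule node_prod_le[OF y]) (use i in auto)
      also have "\<dots> \<le> e * d ^ (m - 1)" using i yi d by (intro mult_right_mono) auto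
      finally have "?t \<le> M * (e * d ^ (m - 1))"
        using M(1) M(2)[of "y i"] node_tuples_bounds[OF y im] by (intro mult_mono) auto
      also have "\<dots> = (M * d ^ (m - 1)) * e" by simp
      also have "\<dots> \<le> (M * d ^ (m - 1)) * (1 / (M * d ^ (m - 1) * S0))"
        using e(3) M(1) d by (intro mult_left_mono) auto
      also have "\<dots> = 1 / S0" using M(1) d by simp
      finally have "S0 \<le> 1 / ?t" using \<open>?t > 0\<close> \<open>S0 > 0\<close> by (simp add: field_simps)
      also have "\<dots> \<le> inverse_deviation w m y" unfolding inverse_deviation_def
        using term_pos[OF y] im by (intro member_le_sum[of i "{..m}"]) (auto intro: less_imp_le)
      finally show ?thesis using x(2)[OF \<open>x0 \<in> K\<close>] by (simp add: S0_def)
    qed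
  qed
qed

text \<open>
  At nodes of maximal deviation \<open>E\<close>, an interior node \<open>x\<^sub>i\<close> is critical: otherwise it could be
  moved to a nearby point where \<open>|W p|\<close> exceeds \<open>E\<close>, and the divided difference formula for \<open>p\<close>
  at the new nodes would give them a larger deviation. The bounds come from the Lagrange
  form of \<open>p\<close>, all of whose terms are positive to the right of the nodes.
\<close>
lemma weighted_alternation:
  fixes W :: "real poly"
  assumes m: "m \<ge> 1" and d: "d > 0" and W: "\<And>t. 0 \<le> t \<Longrightarrow> t \<le> d \<Longrightarrow> poly W t > 0"
  obtains x E p where "x \<in> node_tuples m d" "E > 0" "degree p = m" "lead_coeff p = 1"
    "\<forall>i\<le>m. poly (W * p) (x i) = (-1) ^ (m - i) * E"
    "\<forall>i. 0 < i \<and> i < m \<longrightarrow> poly (pderiv (W * p)) (x i) = 0"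
    "\<forall>y>d. poly p y \<ge> (y - d) ^ m"
    "E \<le> poly W 0 * d ^ m"
proof -
  let ?S = "inverse_deviation (poly W) m"
  obtain x where x: "x \<in> node_tuples m d" and opt: "\<And>y. y \<in> node_tuples m d \<Longrightarrow> ?S x \<le> ?S y"
  proof (rule optimal_nodes[OF m d, of "poly W"])
    show "continuous_on {0..d} (poly W)" by (intro continuous_intros)
  qed (use W in auto)
  have term_pos: "1 / (poly W (y i) * \<bar>node_prod y m i\<bar>) > 0" if "y \<in> node_tuples m d" "i \<le> m" for y i
    using W[of "y i"] node_tuples_bounds[OF that] node_prod_sign(2)[OF that] by simp
  have S_pos: "?S x > 0" unfolding inverse_deviation_def using term_pos[OF x] by (intro sum_pos) auto
  define E where "E = 1 / ?S x"
  have E: "E > 0" "E * ?S x = 1" using S_pos by (auto simp: E_def)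
  have W_x: "poly W (y i) > 0" if "y \<in> node_tuples m d" "i \<le> m" for y i
    using W node_tuples_bounds[OF that] by blast
  have sgn_div: "(-1) ^ (m - i) * c / node_prod y m i = c / \<bar>node_prod y m i\<bar>"
    if "y \<in> node_tuples m d" "i \<le> m" for y i c
  proof -
    have "(-1) ^ (m - i) * c / node_prod y m i = (-1) ^ (m - i) * c * ((-1) ^ (m - i)) / ((-1) ^ (m - i) * node_prod y m i)"
      by simp
    also have "\<dots> = c / \<bar>node_prod y m i\<bar>" unfolding node_prod_sign(1)[OF that]
      by (simp flip: power_mult_distrib power_add add: mult.commute mult.left_commute)
    finally show ?thesis .
  qed
  define v where "v i = (-1) ^ (m - i) * (E / poly W (x i))" for i
  have v: "v i / node_prod x m i = E * (1 / (poly W (x i) * \<bar>node_prod x m i\<bar>))" if "i \<le> m" for i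
    unfolding v_def sgn_div[OF x that] by simp
  obtain p where p: "degree p \<le> m" "\<forall>i\<le>m. poly p (x i) = v i"
    "coeff p m = (\<Sum>i\<le>m. v i / node_prod x m i)"
    "\<And>y. poly p y = (\<Sum>i\<le>m. v i / node_prod x m i * (\<Prod>j\<in>{..m} - {i}. y - x j))"
    using lagrange_interpolation[OF node_tuples_inj[OF x], of v] by blast
  have sum1: "(\<Sum>i\<le>m. v i / node_prod x m i) = 1"
    using v E(2) by (simp add: inverse_deviation_def sum_distrib_left)
  have deg: "degree p = m" and lc: "lead_coeff p = 1"
    using p(1,3) sum1 le_degree[of p m] by auto
  have val: "poly (W * p) (x i) = (-1) ^ (m - i) * E" if "i \<le> m" for i
    using p(2) W_x[OF x that] that by (simp add: v_def)
  have crit: "poly (pderiv (W * p)) (x i) = 0" if i: "0 < i" "i < m" for i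
  proof (rule ccontr)
    assume nz: "poly (pderiv (W * p)) (x i) \<noteq> 0"
    define f where "f = smult ((-1) ^ (m - i)) (W * p)"
    have f_x: "poly f (x i) = E" using val[of i] i by (simp add: f_def flip: power_mult_distrib mult.assoc)
    have df: "poly (pderiv f) (x i) \<noteq> 0" using nz by (simp add: f_def pderiv_smult)
    define h where "h = min (x i - x (i - 1)) (x (Suc i) - x i)"
    have h: "h > 0" using node_tuples_less[OF x, of "i - 1" i] node_tuples_less[OF x, of i "Suc i"] i by (auto simp: h_def)
    obtain t where t: "\<bar>t - x i\<bar> < h" "poly f t > E"
    proof (cases "poly (pderiv f) (x i) > 0")
      case True
      then obtain e where e: "e > 0" "\<And>k. 0 < k \<Longrightarrow> k < e \<Longrightarrow> poly f (x i) < poly f (x i + k)"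
        using DERIV_pos_inc_right[OF poly_DERIV True] by blast
      define k where "k = min e h / 2"
      show ?thesis using that[of "x i + k"] e(2)[of k] e(1) h f_x by (auto simp: k_def min_def)
    next
      case False
      hence neg: "poly (pderiv f) (x i) < 0" using df by simp
      then obtain e where e: "e > 0" "\<And>k. 0 < k \<Longrightarrow> k < e \<Longrightarrow> poly f (x i) < poly f (x i - k)"
        using DERIV_neg_dec_left[OF poly_DERIV neg] by blast
      define k where "k = min e h / 2"
      show ?thesis using that[of "x i - k"] e(2)[of k] e(1) h f_x by (auto simp: k_def min_def)
    qed
    define y where "y = x(i := t)"
    have tb: "x (i - 1) < t" "t < x (Suc i)" using t(1) by (auto simp: h_def abs_less_iff)
    have y: "y \<in> node_tuples m d"
      unfolding node_tuples_def
    proof (intro CollectI conjI allI impI)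
      show "y 0 = 0" "y m = d" using x i by (auto simp: y_def node_tuples_def)
      fix j assume "j < m"
      thus "y j < y (Suc j)" using x tb by (auto simp: y_def node_tuples_def)
    qed
    define c where "c j = (-1) ^ (m - j) * poly (W * p) (y j)" for j
    have c: "c j = (if j = i then poly f t else E)" if "j \<le> m" for j
    proof (cases "j = i")
      case False
      hence "c j = (-1) ^ (m - j) * poly (W * p) (x j)" by (simp add: c_def y_def)
      also have "\<dots> = E" unfolding val[OF that] by (simp flip: power_mult_distrib mult.assoc)
      finally show ?thesis using False by simp
    qed (simp add: c_def y_def f_def)
    \<comment> \<open>the divided difference of \<open>p\<close> at the new nodes, term by term at least \<open>E\<close> times their sum\<close>
    have "1 = coeff p m" using lc deg by simp
    also have "\<dots> = (\<Sum>j\<le>m. poly p (y j) / node_prod y m j)"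
      by (rule coeff_eq_divided_difference[OF node_tuples_inj[OF y] p(1)])
    also have "\<dots> = (\<Sum>j\<le>m. c j * (1 / (poly W (y j) * \<bar>node_prod y m j\<bar>)))"
    proof (intro sum.cong refl)
      fix j assume "j \<in> {..m}"
      hence j: "j \<le> m" by simp
      have "poly p (y j) = (-1) ^ (m - j) * (c j / poly W (y j))"
        using W_x[OF y j] by (simp add: c_def flip: power_mult_distrib mult.assoc)
      hence "poly p (y j) / node_prod y m j = (c j / poly W (y j)) / \<bar>node_prod y m j\<bar>"
        by (simp only: sgn_div[OF y j])
      thus "poly p (y j) / node_prod y m j = c j * (1 / (poly W (y j) * \<bar>node_prod y m j\<bar>))"
        by simp
    qed
    finally have one: "1 = (\<Sum>j\<le>m. c j * (1 / (poly W (y j) * \<bar>node_prod y m j\<bar>)))" .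
    have "(\<Sum>j\<le>m. E * (1 / (poly W (y j) * \<bar>node_prod y m j\<bar>)))
        < (\<Sum>j\<le>m. c j * (1 / (poly W (y j) * \<bar>node_prod y m j\<bar>)))"
    proof (rule sum_strict_mono_ex1)
      show "\<forall>j\<in>{..m}. E * (1 / (poly W (y j) * \<bar>node_prod y m j\<bar>)) \<le> c j * (1 / (poly W (y j) * \<bar>node_prod y m j\<bar>))"
        using term_pos[OF y] t(2) by (intro ballI mult_right_mono) (auto simp: c intro: less_imp_le)
      show "\<exists>j\<in>{..m}. E * (1 / (poly W (y j) * \<bar>node_prod y m j\<bar>)) < c j * (1 / (poly W (y j) * \<bar>node_prod y m j\<bar>))"
        using term_pos[OF y, of i] t(2) i by (intro bexI[of _ i] mult_strict_right_mono) (auto simp: c)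
    qed simp
    moreover have "(\<Sum>j\<le>m. E * (1 / (poly W (y j) * \<bar>node_prod y m j\<bar>))) = E * ?S y"
      by (simp add: inverse_deviation_def sum_distrib_left)
    moreover have "E * ?S x \<le> E * ?S y" using opt[OF y] E(1) by (intro mult_left_mono) auto
    ultimately show False using E(2) one by linarith
  qed
  have lower: "poly p y \<ge> (y - d) ^ m" if "y > d" for y
  proof -
    have "(y - d) ^ m = (\<Sum>i\<le>m. v i / node_prod x m i * (y - d) ^ m)"
      unfolding sum_distrib_right[symmetric] sum1 by simp
    also have "\<dots> \<le> poly p y" unfolding p(4)
    proof (intro sum_mono mult_left_mono)
      fix i assume "i \<in> {..m}"
      hence i: "i \<le> m" by simp
      have "(y - d) ^ m = (\<Prod>j\<in>{..m} - {i}. y - d)" using i by simp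
      also have "\<dots> \<le> (\<Prod>j\<in>{..m} - {i}. y - x j)"
        using node_tuples_bounds[OF x] that by (intro prod_mono) auto
      finally show "(y - d) ^ m \<le> (\<Prod>j\<in>{..m} - {i}. y - x j)" .
      show "0 \<le> v i / node_prod x m i" unfolding v[OF i] using E(1) term_pos[OF x i] by simp
    qed
    finally show ?thesis .
  qed
  have "E \<le> poly W 0 * d ^ m"
  proof -
    have x0: "x 0 = 0" "x m = d" using x by (auto simp: node_tuples_def)
    have "E * (1 / (poly W (x 0) * \<bar>node_prod x m 0\<bar>)) \<le> E * ?S x"
      unfolding inverse_deviation_def using E(1) term_pos[OF x]
      by (intro mult_left_mono member_le_sum[of 0 "{..m}"]) (auto intro: less_imp_le)
    hence "E \<le> poly W 0 * \<bar>node_prod x m 0\<bar>"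
      using E W_x[OF x, of 0] node_prod_sign(2)[OF x, of 0] x0 by (simp add: field_simps)
    also have "\<bar>node_prod x m 0\<bar> \<le> d * d ^ (m - 1)"
      using node_prod_le[OF x, of 0 m] m d x0 by simp
    also have "d * d ^ (m - 1) = d ^ m" using m by (simp add: power_eq_if)
    finally show ?thesis using W[of 0] d by (simp add: mult_left_mono)
  qed
  thus ?thesis using that[of x E p] x E deg lc val crit lower by blast
qed

section \<open>Polynomial factors from real roots\<close>

lemma coprime_distinct_linear:
  fixes a b :: real
  assumes "a \<noteq> b"
  shows "coprime [:-a, 1:] [:-b, 1:]"
proof (rule coprimeI)
  fix c :: "real poly" assume "c dvd [:-a, 1:]" "c dvd [:-b, 1:]"
  hence "c dvd [:-a, 1:] - [:-b, 1:]" by (rule dvd_diff)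
  also have "[:-a, 1:] - [:-b, 1:] = [:b - a:]" by simp
  finally show "is_unit c" using assms by (simp add: dvd_unit_imp_unit is_unit_pCons_iff dvd_trans)
qed

lemma linear_power_prod_dvd:
  fixes R :: "real poly"
  assumes "finite A" "\<And>a. a \<in> A \<Longrightarrow> [:-a, 1:] ^ n a dvd R"
  shows "(\<Prod>a\<in>A. [:-a, 1:] ^ n a) dvd R"
  using assms
proof (induction A rule: finite_induct)
  case (insert a A)
  have "coprime ([:-a, 1:] ^ n a) (\<Prod>b\<in>A. [:-b, 1:] ^ n b)"
    using insert.hyps by (intro prod_coprime_right) (auto intro!: coprime_distinct_linear)
  thus ?case using insert by (auto intro: divides_mult)
qed auto

lemma double_root_dvd:
  fixes R :: "real poly"
  assumes "poly R a = 0" "poly (pderiv R) a = 0"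
  shows "[:-a, 1:] ^ 2 dvd R"
proof -
  obtain S where S: "R = [:-a, 1:] * S" using assms(1) by (auto simp: poly_eq_0_iff_dvd)
  have "poly S a = 0" using assms(2) unfolding S pderiv_mult by (simp add: pderiv_pCons)
  then obtain T where "S = [:-a, 1:] * T" by (auto simp: poly_eq_0_iff_dvd)
  thus ?thesis unfolding S power2_eq_square by (metis dvd_triv_left mult.assoc)
qed

lemma monic_dvd_same_degree_eq:
  fixes R S :: "'a::field poly"
  assumes "S dvd R" "degree S = degree R" "lead_coeff S = 1" "lead_coeff R = 1"
  shows "R = S"
proof -
  obtain T where T: "R = S * T" using assms(1) by (rule dvdE)
  hence "S \<noteq> 0" "T \<noteq> 0" using assms by auto
  hence "degree T = 0" using assms(2) T by (simp add: degree_mult_eq)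
  then obtain c where c: "T = [:c:]" by (rule degree_eq_zeroE)
  have "lead_coeff R = c" unfolding T lead_coeff_mult using assms(3) c by simp
  hence "c = 1" using assms(4) by simp
  thus ?thesis using T c by simp
qed

section \<open>Totally real curves with a simple band\<close>

text \<open>
  The construction of \<open>P = F/E\<close> described at the beginning. The simple band is the one around
  the zero \<open>1\<close>: all zeros of \<open>Q\<close> are interior nodes and lie to its left.
\<close>
lemma totally_real_pell_exists:
  assumes m: "m \<ge> 1"
  obtains P Q D :: "real poly" and A :: "real set" where
    "finite A" "card A = 2 * g + 2" "D = (\<Prod>a\<in>A. [:-a, 1:])"
    "P\<^sup>2 - D * Q\<^sup>2 = 1" "degree P = g + m"
    "g \<ge> 1 \<longrightarrow> (\<exists>a b. a \<in> A \<and> b \<in> A \<and> a < b \<and> (\<forall>x. a < x \<and> x < b \<longrightarrow> poly Q x \<noteq> 0) \<and> poly P a \<noteq> poly P b)"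
proof -
  define W :: "real poly" where "W = (\<Prod>l<g. [:real l + 1, -1:])"
  have poly_W: "poly W t = (\<Prod>l<g. real l + 1 - t)" for t by (simp add: W_def poly_prod)
  have deg_W: "degree W = g" unfolding W_def by (subst degree_prod_eq_sum_degree) auto
  have lc_W: "lead_coeff W = (-1) ^ g" unfolding W_def by (subst lead_coeff_prod) auto
  have W0: "poly W 0 = fact g" unfolding poly_W by (induction g) (simp_all add: mult.commute add.commute)
  \<comment> \<open>chosen so that \<open>E \<le> g! d ^ m\<close> is below \<open>(1/2) ^ g (1/4) ^ m\<close>, a lower bound of \<open>|F|\<close> at the half-integers\<close>
  define d :: real where "d = (1/4) ^ m * (1/2) ^ g / (2 * fact g)"
  have d: "d > 0" by (simp add: d_def)
  have f1: "(fact g :: real) \<ge> 1" by (rule fact_ge_1)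
  have "d \<le> (1/4) ^ 1 * 1 / (2 * 1)" unfolding d_def
    using m f1 by (intro frac_le mult_mono power_decreasing power_le_one) auto
  hence d4: "d < 1/4" by simp
  have W_pos: "poly W t > 0" if "0 \<le> t" "t \<le> d" for t
    unfolding poly_W using that d4 by (intro prod_pos) auto
  obtain x p E where x: "x \<in> node_tuples m d" and E: "E > 0" and p: "degree p = m" "lead_coeff p = 1"
    and val': "\<forall>i\<le>m. poly (W * p) (x i) = (-1) ^ (m - i) * E"
    and crit': "\<forall>i. 0 < i \<and> i < m \<longrightarrow> poly (pderiv (W * p)) (x i) = 0"
    and lower': "\<forall>y>d. poly p y \<ge> (y - d) ^ m"
    and E_le: "E \<le> poly W 0 * d ^ m"
    by (rule weighted_alternation[OF m d W_pos])
  define F where "F = W * p"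
  have val: "poly F (x i) = (-1) ^ (m - i) * E" if "i \<le> m" for i
    using val' that by (simp add: F_def)
  have crit: "poly (pderiv F) (x i) = 0" if "0 < i" "i < m" for i
    using crit' that by (simp add: F_def)
  have lower: "poly p y \<ge> (y - d) ^ m" if "y > d" for y
    using lower' that by simp
  have nz: "W \<noteq> 0" "p \<noteq> 0" using lc_W p by auto
  have deg_F: "degree F = g + m" using nz deg_W p by (simp add: F_def degree_mult_eq)
  have lc_F: "lead_coeff F = (-1) ^ g" using lc_W p by (simp add: F_def lead_coeff_mult)
  have large: "(-1) ^ j * poly F (real j + 1/2) > E" if j: "j \<le> g" for j
  proof -
    let ?y = "real j + 1/2"
    have s: "{..<g} = {..<j} \<union> {j..<g}" using j by auto
    have "poly W ?y = (\<Prod>l<j. real l + 1 - ?y) * (\<Prod>l\<in>{j..<g}. real l + 1 - ?y)"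
      unfolding poly_W s by (rule prod.union_disjoint) auto
    also have "(\<Prod>l<j. real l + 1 - ?y) = (\<Prod>l<j. (-1) * (?y - (real l + 1)))"
      by (intro prod.cong) auto
    also have "\<dots> = (-1) ^ j * (\<Prod>l<j. ?y - (real l + 1))" unfolding prod.distrib by simp
    finally have "(-1) ^ j * poly W ?y = (\<Prod>l<j. ?y - (real l + 1)) * (\<Prod>l\<in>{j..<g}. real l + 1 - ?y)"
      by (simp flip: power_mult_distrib mult.assoc)
    also have "\<dots> \<ge> (\<Prod>l<j. 1/2) * (\<Prod>l\<in>{j..<g}. 1/2)"
      by (intro mult_mono prod_mono prod_nonneg conjI) (auto simp flip: of_nat_Suc)
    also have "(\<Prod>l<j. 1/2 :: real) * (\<Prod>l\<in>{j..<g}. 1/2) = (1/2) ^ g"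
      using j by (simp flip: power_add)
    finally have W_ge: "(-1) ^ j * poly W ?y \<ge> (1/2) ^ g" .
    have "(1/4) ^ m \<le> (?y - d) ^ m" using d4 by (intro power_mono) auto
    also have "\<dots> \<le> poly p ?y" using d4 by (intro lower) auto
    finally have p_ge: "(1/4) ^ m \<le> poly p ?y" .
    have "d ^ m \<le> d ^ 1" using m d d4 by (intro power_decreasing) auto
    hence "E \<le> fact g * d" using E_le W0 by (metis fact_ge_zero mult_left_mono order.trans power_one_right)
    also have "\<dots> < (1/2) ^ g * (1/4) ^ m" by (simp add: d_def)
    also have "\<dots> \<le> ((-1) ^ j * poly W ?y) * poly p ?y"
      using W_ge p_ge by (intro mult_mono) (auto intro: order.trans[of 0 "(1/2)^g"])
    finally show ?thesis by (simp add: F_def)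
  qed
  have zero: "poly F (real l + 1) = 0" if "l < g" for l
    using that by (auto simp: F_def poly_W)
  have "\<forall>l. \<exists>a. l < g \<longrightarrow> real l + 1/2 < a \<and> a < real l + 1 \<and> poly F a = (-1) ^ l * E"
  proof
    fix l
    show "\<exists>a. l < g \<longrightarrow> real l + 1/2 < a \<and> a < real l + 1 \<and> poly F a = (-1) ^ l * E"
    proof (cases "l < g")
      case True
      let ?f = "smult ((-1) ^ l) F - [:E:]"
      have "\<exists>a. real l + 1/2 < a \<and> a < real l + 1 \<and> poly ?f a = 0"
        using large[of l] zero[of l] True E by (intro poly_IVT_neg) auto
      then obtain a where a: "real l + 1/2 < a" "a < real l + 1" "(-1) ^ l * poly F a = E" by auto
      have "poly F a = (-1) ^ l * ((-1) ^ l * poly F a)" by (simp flip: power_mult_distrib mult.assoc)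
      thus ?thesis using a by auto
    qed auto
  qed
  then obtain \<alpha> where \<alpha>: "\<And>l. l < g \<Longrightarrow> real l + 1/2 < \<alpha> l" "\<And>l. l < g \<Longrightarrow> \<alpha> l < real l + 1"
    "\<And>l. l < g \<Longrightarrow> poly F (\<alpha> l) = (-1) ^ l * E" by metis
  have "\<forall>l. \<exists>b. l < g \<longrightarrow> real l + 1 < b \<and> b < real l + 3/2 \<and> poly F b = - ((-1) ^ l * E)"
  proof
    fix l
    show "\<exists>b. l < g \<longrightarrow> real l + 1 < b \<and> b < real l + 3/2 \<and> poly F b = - ((-1) ^ l * E)"
    proof (cases "l < g")
      case True
      let ?f = "smult ((-1) ^ l) F + [:E:]"
      have y: "real (Suc l) + 1/2 = real l + 3/2" by simp
      have "(-1) ^ Suc l * poly F (real l + 3/2) > E"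
        using large[of "Suc l"] True unfolding y by simp
      hence "(-1) ^ l * poly F (real l + 3/2) < - E" by simp
      hence "\<exists>b. real l + 1 < b \<and> b < real l + 3/2 \<and> poly ?f b = 0"
        using zero[of l] True E by (intro poly_IVT_neg) auto
      then obtain b where b: "real l + 1 < b" "b < real l + 3/2" "(-1) ^ l * poly F b = - E"
        by (auto simp: eq_neg_iff_add_eq_0)
      have "poly F b = (-1) ^ l * ((-1) ^ l * poly F b)" by (simp flip: power_mult_distrib mult.assoc)
      thus ?thesis using b by auto
    qed auto
  qed
  then obtain \<beta> where \<beta>: "\<And>l. l < g \<Longrightarrow> real l + 1 < \<beta> l" "\<And>l. l < g \<Longrightarrow> \<beta> l < real l + 3/2"
    "\<And>l. l < g \<Longrightarrow> poly F (\<beta> l) = - ((-1) ^ l * E)" by metis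
  define A where "A = {0, d} \<union> (\<alpha> ` {..<g} \<union> \<beta> ` {..<g})"
  define X where "X = x ` {0<..<m}"
  have fin: "finite A" "finite X" by (auto simp: A_def X_def)
  have injs: "inj_on \<alpha> {..<g}" "inj_on \<beta> {..<g}"
  proof -
    have "k = l" if "real k < c" "c < real k + 1" "real l < c" "c < real l + 1" for k l c
      using that by linarith
    note * = this
    show "inj_on \<alpha> {..<g}"
    proof (rule inj_onI)
      fix k l assume "k \<in> {..<g}" "l \<in> {..<g}" "\<alpha> k = \<alpha> l"
      thus "k = l" using \<alpha>(1,2)[of k] \<alpha>(1,2)[of l] by (intro *[of k "\<alpha> k" l]) auto
    qed
    show "inj_on \<beta> {..<g}"
    proof (rule inj_onI)
      fix k l assume "k \<in> {..<g}" "l \<in> {..<g}" "\<beta> k = \<beta> l"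
      thus "k = l" using \<beta>(1,2)[of k] \<beta>(1,2)[of l] by (intro *[of k "\<beta> k - 1" l]) auto
    qed
  qed
  have disj: "\<alpha> ` {..<g} \<inter> \<beta> ` {..<g} = {}"
  proof -
    have "\<alpha> k \<noteq> \<beta> l" if "k < g" "l < g" for k l
    proof
      assume "\<alpha> k = \<beta> l"
      hence "real k + 1/2 < real l + 3/2" "real l + 1 < real k + 1"
        using \<alpha>(1,2)[OF that(1)] \<beta>(1,2)[OF that(2)] by auto
      hence "real l < real k" "real k < real (Suc l)" by auto
      thus False unfolding of_nat_less_iff by simp
    qed
    thus ?thesis by auto
  qed
  have disj2: "{0, d} \<inter> (\<alpha> ` {..<g} \<union> \<beta> ` {..<g}) = {}"
  proof -
    have "t > d \<and> t > 0" if "t \<in> \<alpha> ` {..<g} \<union> \<beta> ` {..<g}" for t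
      using that \<alpha>(1) \<beta>(1) d4 d by (fastforce intro: less_trans[of d "1/4"])
    thus ?thesis by fastforce
  qed
  have card_A: "card A = 2 * g + 2"
    unfolding A_def using d disj disj2 injs
    by (simp add: card_Un_disjoint card_image)
  have x_inner: "0 < x i \<and> x i < d" if "i \<in> {0<..<m}" for i
    using node_tuples_less[OF x, of 0 i] node_tuples_less[OF x, of i m] that x by (auto simp: node_tuples_def)
  have AX: "A \<inter> X = {}"
  proof -
    have "t = 0 \<or> t \<ge> d" if "t \<in> A" for t
      using that \<alpha>(1) \<beta>(1) d4 by (fastforce simp: A_def intro: less_imp_le less_trans[of d "1/4"])
    thus ?thesis using x_inner unfolding X_def by fastforce
  qed
  have card_X: "card X = m - 1"
    unfolding X_def by (subst card_image) (auto intro: inj_on_subset[OF node_tuples_inj[OF x]])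
  define D where "D = (\<Prod>a\<in>A. [:-a, 1:])"
  define Q where "Q = (\<Prod>a\<in>X. [:-a, 1:])"
  define R where "R = F\<^sup>2 - [:E\<^sup>2:]"
  \<comment> \<open>the zeros of \<open>F\<^sup>2 - E\<^sup>2\<close> found so far, with multiplicity, exhaust its degree\<close>
  define n where "n a = (if a \<in> X then 2 else 1 :: nat)" for a
  have "D * Q\<^sup>2 = (\<Prod>a\<in>A. [:-a, 1:] ^ n a) * (\<Prod>a\<in>X. [:-a, 1:] ^ n a)"
    using AX by (auto simp: D_def Q_def n_def prod_power_distrib intro!: arg_cong2[of _ _ _ _ "(*)"] prod.cong)
  also have "\<dots> = (\<Prod>a\<in>A \<union> X. [:-a, 1:] ^ n a)"
    by (rule prod.union_disjoint[symmetric]) (use fin AX in auto)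
  finally have DQ: "D * Q\<^sup>2 = (\<Prod>a\<in>A \<union> X. [:-a, 1:] ^ n a)" .
  have "(\<Prod>a\<in>A \<union> X. [:-a, 1:] ^ n a) dvd R"
  proof (rule linear_power_prod_dvd)
    fix a assume a: "a \<in> A \<union> X"
    have sq: "poly R t = 0" if "poly F t = s * E" "s\<^sup>2 = 1" for s t
      using that by (simp add: R_def power_mult_distrib)
    have unit: "((-1) ^ k)\<^sup>2 = (1 :: real)" "(- ((-1) ^ k))\<^sup>2 = (1 :: real)" for k
      by (simp_all flip: power_mult)
    have sqx: "poly R (x i) = 0" if "i \<le> m" for i
      by (rule sq[OF val[OF that] unit(1)])
    have R0: "poly R a = 0"
    proof -
      consider "a = x 0" | "a = x m" | l where "l < g" "a = \<alpha> l" | l where "l < g" "a = \<beta> l"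
        | i where "i \<in> {0<..<m}" "a = x i"
        using a x by (auto simp: A_def X_def node_tuples_def)
      thus ?thesis
      proof cases
        case (3 l)
        thus ?thesis using sq[OF \<alpha>(3)[OF 3(1)] unit(1)] by simp
      next
        case (4 l)
        have "poly F a = (- ((-1) ^ l)) * E" using 4 \<beta>(3) by simp
        thus ?thesis by (rule sq[OF _ unit(2)])
      qed (auto intro: sqx)
    qed
    show "[:-a, 1:] ^ n a dvd R"
    proof (cases "a \<in> X")
      case True
      hence "poly (pderiv F) a = 0" using crit by (auto simp: X_def)
      hence "poly (pderiv R) a = 0" by (simp add: R_def pderiv_diff pderiv_power pderiv_pCons)
      thus ?thesis using double_root_dvd[OF R0] True by (simp add: n_def)
    next
      case False
      thus ?thesis using R0 by (simp add: n_def poly_eq_0_iff_dvd)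
    qed
  qed (use fin in auto)
  hence dvd: "D * Q\<^sup>2 dvd R" using DQ by simp
  have D: "degree D = 2 * g + 2" "lead_coeff D = 1"
    unfolding D_def lead_coeff_prod using card_A by (simp_all add: degree_prod_eq_sum_degree)
  have Q: "degree Q = m - 1" "lead_coeff Q = 1"
    unfolding Q_def lead_coeff_prod using card_X by (simp_all add: degree_prod_eq_sum_degree)
  have nz': "D \<noteq> 0" "Q \<noteq> 0" "F \<noteq> 0" using D Q lc_F by auto
  have "degree R = degree (F\<^sup>2)" unfolding R_def using deg_F m nz'
    by (subst diff_conv_add_uminus, subst degree_add_eq_left) (auto simp: degree_power_eq)
  hence deg_R: "degree R = 2 * (g + m)" using deg_F nz' by (simp add: degree_power_eq)
  have "coeff [:E\<^sup>2:] (2 * (g + m)) = 0" using m by (intro coeff_eq_0) auto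
  moreover have "degree (F\<^sup>2) = 2 * (g + m)" using deg_F nz' by (simp add: degree_power_eq)
  ultimately have "lead_coeff R = lead_coeff (F\<^sup>2)" unfolding deg_R by (simp add: R_def)
  hence lc_R: "lead_coeff R = 1" using lc_F by (simp add: lead_coeff_power flip: power_mult)
  have "R = D * Q\<^sup>2"
  proof (rule monic_dvd_same_degree_eq[OF dvd])
    show "degree (D * Q\<^sup>2) = degree R"
      using deg_R D Q nz' m by (simp add: degree_mult_eq degree_power_eq)
    show "lead_coeff (D * Q\<^sup>2) = 1" unfolding lead_coeff_mult lead_coeff_power D(2) Q(2) by simp
  qed (rule lc_R)
  hence eq: "F\<^sup>2 - D * Q\<^sup>2 = [:E\<^sup>2:]" by (simp add: R_def algebra_simps)
  show ?thesis
  proof (rule that[of A D "smult (1 / E) F" "smult (1 / E) Q"])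
    have "(smult (1 / E) F)\<^sup>2 - D * (smult (1 / E) Q)\<^sup>2 = smult ((1 / E)\<^sup>2) (F\<^sup>2 - D * Q\<^sup>2)"
      by (simp add: power2_eq_square smult_diff_right)
    also have "\<dots> = 1" unfolding eq using E by (simp add: power2_eq_square one_pCons)
    finally show "(smult (1 / E) F)\<^sup>2 - D * (smult (1 / E) Q)\<^sup>2 = 1" .
    show "degree (smult (1 / E) F) = g + m" using E deg_F by simp
    show "g \<ge> 1 \<longrightarrow> (\<exists>a b. a \<in> A \<and> b \<in> A \<and> a < b \<and>
        (\<forall>x. a < x \<and> x < b \<longrightarrow> poly (smult (1 / E) Q) x \<noteq> 0) \<and>
        poly (smult (1 / E) F) a \<noteq> poly (smult (1 / E) F) b)"
    proof
      assume g: "g \<ge> 1"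
      hence "0 < g" by simp
      have "\<alpha> 0 < \<beta> 0" using \<alpha>(2)[OF \<open>0 < g\<close>] \<beta>(1)[OF \<open>0 < g\<close>] by simp
      moreover have "poly (smult (1 / E) Q) t \<noteq> 0" if "\<alpha> 0 < t" for t
      proof -
        have "d < t" using that \<alpha>(1)[OF \<open>0 < g\<close>] d4 by simp
        moreover have "s < d" if "s \<in> X" for s using x_inner that by (auto simp: X_def)
        ultimately have "t \<notin> X" by fastforce
        thus ?thesis using E fin by (auto simp: Q_def poly_prod)
      qed
      moreover have "poly (smult (1 / E) F) (\<alpha> 0) \<noteq> poly (smult (1 / E) F) (\<beta> 0)"
        using \<alpha>(3)[OF \<open>0 < g\<close>] \<beta>(3)[OF \<open>0 < g\<close>] E by simp
      moreover have "\<alpha> 0 \<in> A" "\<beta> 0 \<in> A" using g by (auto simp: A_def)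
      ultimately show "\<exists>a b. a \<in> A \<and> b \<in> A \<and> a < b \<and>
          (\<forall>x. a < x \<and> x < b \<longrightarrow> poly (smult (1 / E) Q) x \<noteq> 0) \<and>
          poly (smult (1 / E) F) a \<noteq> poly (smult (1 / E) F) b"
        by blast
    qed
  qed (use fin card_A in \<open>auto simp: D_def\<close>)
qed

lemma poly_of_real_map_poly:
  "poly (map_poly of_real p) (of_real x) = (of_real (poly p x) :: complex)"
  by (induction p) (auto simp: map_poly_pCons)

lemma complex_poly_eqI_real:
  fixes p q :: "complex poly"
  assumes "\<And>x::real. poly p (of_real x) = poly q (of_real x)"
  shows "p = q"
proof (rule ccontr)
  assume "p \<noteq> q"
  hence "finite {z. poly (p - q) z = 0}" by (intro poly_roots_finite) simp
  moreover have "range of_real \<subseteq> {z. poly (p - q) z = 0}" using assms by auto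
  ultimately have "finite (range (of_real :: real \<Rightarrow> complex))" by (rule rev_finite_subset)
  thus False by (simp add: finite_image_iff infinite_UNIV_char_0 inj_of_real)
qed

lemma rsquarefree_prod_linear:
  fixes A :: "'a::field_char_0 set"
  assumes "finite A"
  shows "rsquarefree (\<Prod>a\<in>A. [:-a, 1:])"
  unfolding rsquarefree_roots
proof (intro allI notI, elim conjE)
  fix z assume z: "poly (\<Prod>a\<in>A. [:-a, 1:]) z = 0" "poly (pderiv (\<Prod>a\<in>A. [:-a, 1:])) z = 0"
  hence "z \<in> A" using assms by (auto simp: poly_prod)
  hence "(\<Prod>a\<in>A. [:-a, 1:]) = [:-z, 1:] * (\<Prod>a\<in>A - {z}. [:-a, 1:])"
    using assms by (subst prod.remove) auto
  hence "poly (\<Prod>a\<in>A - {z}. [:-a, 1:]) z = 0"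
    using z(2) by (simp only: pderiv_mult) (simp add: pderiv_pCons)
  thus False using assms by (auto simp: poly_prod)
qed

lemma totally_real_primitive_exists:
  assumes "r > g" and "g \<ge> 1 \<or> r = 1"
  shows "\<exists>D. hyperelliptic g D \<and> totally_real D \<and>
              (\<exists>P Q. primitive_solution D P Q \<and> degree P = r)"
proof -
  obtain P Q D :: "real poly" and A where A: "finite A" "card A = 2 * g + 2" "D = (\<Prod>a\<in>A. [:-a, 1:])"
    and eq: "P\<^sup>2 - D * Q\<^sup>2 = 1" and deg: "degree P = g + (r - g)"
    and band: "g \<ge> 1 \<longrightarrow> (\<exists>a b. a \<in> A \<and> b \<in> A \<and> a < b \<and>
      (\<forall>x. a < x \<and> x < b \<longrightarrow> poly Q x \<noteq> 0) \<and> poly P a \<noteq> poly P b)"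
  proof (rule totally_real_pell_exists[of "r - g" g])
    show "1 \<le> r - g" using assms(1) by simp
  qed
  let ?c = "map_poly complex_of_real"
  have D_eq: "?c D = (\<Prod>a\<in>of_real ` A. [:-a, 1:])"
  proof (rule complex_poly_eqI_real)
    fix x :: real
    show "poly (?c D) (of_real x) = poly (\<Prod>a\<in>of_real ` A. [:-a, 1:]) (of_real x)"
      unfolding poly_of_real_map_poly A(3)
      by (subst prod.reindex) (auto simp: poly_prod inj_on_def)
  qed
  have card: "card (complex_of_real ` A) = 2 * g + 2"
    using A by (subst card_image) (auto simp: inj_on_def)
  have degD: "degree (?c D) = 2 * g + 2"
    unfolding D_eq using card by (subst degree_prod_eq_sum_degree) auto
  have hyper: "hyperelliptic g (?c D)"
    using degD A(1) unfolding hyperelliptic_def D_eq by (auto intro!: rsquarefree_prod_linear)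
  have real: "totally_real (?c D)"
    using A(1) unfolding totally_real_def D_eq by (auto simp: poly_prod)
  have sol: "(?c P)\<^sup>2 - ?c D * (?c Q)\<^sup>2 = 1"
  proof (rule complex_poly_eqI_real)
    fix x :: real
    have "poly ((?c P)\<^sup>2 - ?c D * (?c Q)\<^sup>2) (of_real x) = of_real (poly (P\<^sup>2 - D * Q\<^sup>2) x)"
      by (simp add: poly_of_real_map_poly)
    thus "poly ((?c P)\<^sup>2 - ?c D * (?c Q)\<^sup>2) (of_real x) = poly 1 (of_real x)"
      unfolding eq by simp
  qed
  have degP: "degree (?c P) = r" using deg assms(1) by (simp add: degree_map_poly)
  have "primitive_solution (?c D) (?c P) (?c Q)"
  proof (cases "g \<ge> 1")
    case True
    obtain a b where ab: "a \<in> A" "b \<in> A" "a < b" "\<forall>x. a < x \<and> x < b \<longrightarrow> poly Q x \<noteq> 0" "poly P a \<noteq> poly P b"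
      using band True by blast
    show ?thesis
    proof (rule pell_simple_band_primitive[OF sol _ _ _ ab(3)])
      show "map_poly cnj (?c D) = ?c D" by (rule poly_eqI) (simp add: coeff_map_poly)
      show "poly (?c D) (of_real a) = 0" "poly (?c D) (of_real b) = 0"
        using ab A(1) by (auto simp: D_eq poly_prod)
    qed (use ab degD degP assms in \<open>auto simp: poly_of_real_map_poly\<close>)
  next
    case False
    hence r: "r = 1" "g = 0" using assms by auto
    have nz: "?c Q \<noteq> 0" using pell_zero_iff[OF sol] degD degP r by auto
    have "degree (?c P) \<le> degree P'" if "pell_abel_solution (?c D) P' Q'" for P' Q'
      using that pell_degree[of P' "?c D" Q'] degD degP r by (fastforce simp: pell_abel_solution_def)
    thus ?thesis using sol nz by (auto simp: primitive_solution_def pell_abel_solution_def one_pCons)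
  qed
  thus ?thesis using hyper real degP by blast
qed

theorem mainTheorem1:
  fixes g r :: nat
  assumes "r \<ge> 1" and "g \<ge> 1 \<or> r = 1"
  shows "(\<exists>D. hyperelliptic g D \<and> totally_real D \<and>
              (\<exists>P Q. primitive_solution D P Q \<and> degree P = r))
         \<longleftrightarrow> r > g"
proof
  assume "\<exists>D. hyperelliptic g D \<and> totally_real D \<and> (\<exists>P Q. primitive_solution D P Q \<and> degree P = r)"
  then obtain D P Q where D: "hyperelliptic g D" and PQ: "primitive_solution D P Q" "degree P = r"
    by blast
  obtain c where "Q \<noteq> 0" "P\<^sup>2 - D * Q\<^sup>2 = [:c:]"
    using PQ(1) unfolding primitive_solution_def pell_abel_solution_def by blast
  thus "r > g" using pell_degree[of P D Q c] D PQ(2) by (simp add: hyperelliptic_def)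
next
  assume "r > g"
  thus "\<exists>D. hyperelliptic g D \<and> totally_real D \<and> (\<exists>P Q. primitive_solution D P Q \<and> degree P = r)"
    using assms(2) by (rule totally_real_primitive_exists)
qed

end
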